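(* Let $n\in\mathbb{N}$, $s\in\mathbb{C}\setminus\{-1,-2,-3,\dots\}$ and $x\in\mathbb{C}$. Then \[ \sum_{k=0}^{n}\binom{s+n}{k}x^k=(1+x)^n\left[1+s\sum_{k=0}^{n-1}\frac{\binom{s+k}{k}}{k+1}\left(\frac{x}{x+1}\right)^{k+1}\right]. \]
   Context: For $z\in\mathbb{C}$ and $k\in\mathbb{N}_0$, $\binom{z}{k}=\frac{z(z-1)\cdots(z-k+1)}{k!}$ (equivalently $\frac{\Gamma(z+1)}{k!\,\Gamma(z-k+1)}$, interpreted as $0$ when $z-k+1$ is a pole of $\Gamma$). For $0\le k\le n-1$ the product $(1+x)^n\left(\frac{x}{x+1}\right)^{k+1}$ is understood as the polynomial $x^{k+1}(1+x)^{n-k-1}$, so both sides are polynomials in $x$ and the identity is meaningful for all $x\in\mathbb{C}$, including $x=-1$. *)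

theory Defs
  imports Complex_Main
begin

end

theory Submission
  imports Defs
begin

(* By Pascal's rule the left-hand side F n satisfies
   F (n + 1) = (1 + x) * F n + binom (s + n) (n + 1) * x ^ (n + 1),
   and binom (s + n) (n + 1) = s / (n + 1) * binom (s + n) n.
   Solving this recurrence gives the polynomial identity; for x \<noteq> -1 one may then
   factor out (1 + x) ^ n. *)

text \<open>With \<open>a = s + of_nat n\<close>, the two absorption identities give
  \<open>of_nat (Suc n) * (a gchoose Suc n)\<close> and
  \<open>(a - of_nat n) * (a gchoose n)\<close> the same value
  \<open>a * ((a - 1) gchoose n)\<close>, and \<open>a - of_nat n\<close> is
  \<open>s\<close>.\<close>

lemma gbinomial_add_of_nat_Suc:
  fixes s :: "'a :: field_char_0"
  shows "(s + of_nat n) gchoose Suc n = s * (((s + of_nat n) gchoose n) / of_nat (n + 1))"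
proof -
  have "of_nat (Suc n) * ((s + of_nat n) gchoose Suc n) = s * ((s + of_nat n) gchoose n)"
    using gbinomial_absorb_comp[of "s + of_nat n" n] gbinomial_absorption[of n "s + of_nat n"]
    by simp
  moreover have "(of_nat (Suc n) :: 'a) \<noteq> 0"
    by (rule of_nat_neq_0)
  ultimately show ?thesis
    by (simp add: eq_divide_eq mult.commute del: of_nat_Suc)
qed

lemma gbinomial_truncated_sum_Suc:
  fixes s x :: "'a :: field_char_0"
  shows "(\<Sum>k\<le>Suc n. ((s + of_nat (Suc n)) gchoose k) * x ^ k) =
    (1 + x) * (\<Sum>k\<le>n. ((s + of_nat n) gchoose k) * x ^ k)
      + ((s + of_nat n) gchoose Suc n) * x ^ Suc n"
proof -
  let ?b = "\<lambda>k. (s + of_nat n) gchoose k"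
  have pascal: "(s + of_nat (Suc n)) gchoose Suc k = ?b k + ?b (Suc k)" for k
    using gbinomial_Suc_Suc[of "s + of_nat n" k] by (simp add: ac_simps)
  \<comment> \<open>The term at index 0 is split off first, since Pascal's rule applies only to a
    successor lower index.\<close>
  have "(\<Sum>k\<le>Suc n. ((s + of_nat (Suc n)) gchoose k) * x ^ k) =
      1 + (\<Sum>k\<le>n. (?b k + ?b (Suc k)) * x ^ Suc k)"
    by (simp only: sum.atMost_Suc_shift pascal) simp
  also have "\<dots> = x * (\<Sum>k\<le>n. ?b k * x ^ k) + (1 + (\<Sum>k\<le>n. ?b (Suc k) * x ^ Suc k))"
    by (simp add: algebra_simps sum.distrib sum_distrib_left)
  \<comment> \<open>The 1 is the missing term at index 0. The reassembled sum runs one index past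
    the truncated sum for \<open>n\<close>; its last term is the inhomogeneous term of the
    recurrence.\<close>
  also have "1 + (\<Sum>k\<le>n. ?b (Suc k) * x ^ Suc k) = (\<Sum>k\<le>Suc n. ?b k * x ^ k)"
    by (simp only: sum.atMost_Suc_shift) simp
  finally show ?thesis
    by (simp add: algebra_simps)
qed

text \<open>Induction along the recurrence. Keeping the summands as polynomials avoids division, so
  \<open>x = -1\<close> is covered.\<close>

lemma gbinomial_truncated_sum:
  fixes s x :: "'a :: field_char_0"
  shows "(\<Sum>k\<le>n. ((s + of_nat n) gchoose k) * x ^ k) =
    (1 + x) ^ n + s * (\<Sum>k<n. ((s + of_nat k) gchoose k) / of_nat (k + 1)
      * (x ^ (k + 1) * (1 + x) ^ (n - k - 1)))"
proof (induction n)
  case 0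
  show ?case by simp
next
  case (Suc n)
  let ?c = "\<lambda>k. ((s + of_nat k) gchoose k) / of_nat (k + 1)"
  have "(1 + x) * (\<Sum>k<n. ?c k * (x ^ (k + 1) * (1 + x) ^ (n - k - 1))) =
      (\<Sum>k<n. ?c k * (x ^ (k + 1) * (1 + x) ^ (Suc n - k - 1)))"
    unfolding sum_distrib_left
  proof (rule sum.cong[OF refl])
    fix k assume "k \<in> {..<n}"
    \<comment> \<open>The bound \<open>k < n\<close> keeps the natural subtraction from truncating,
      so the factor \<open>1 + x\<close> raises each exponent by exactly one.\<close>
    then have "Suc n - k - 1 = Suc (n - k - 1)" by auto
    then show "(1 + x) * (?c k * (x ^ (k + 1) * (1 + x) ^ (n - k - 1))) =
        ?c k * (x ^ (k + 1) * (1 + x) ^ (Suc n - k - 1))"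
      by (simp only: power_Suc mult.left_commute)
  qed
  then have "(1 + x) * ((1 + x) ^ n + s * (\<Sum>k<n. ?c k * (x ^ (k + 1) * (1 + x) ^ (n - k - 1)))) =
      (1 + x) ^ Suc n + s * (\<Sum>k<n. ?c k * (x ^ (k + 1) * (1 + x) ^ (Suc n - k - 1)))"
    by (simp only: distrib_left[of "1 + x"] mult.left_commute[of "1 + x" s] power_Suc)
  \<comment> \<open>The inhomogeneous term becomes the new summand at \<open>k = n\<close>, where
    the exponent of \<open>1 + x\<close> is \<open>Suc n - n - 1 = 0\<close>.\<close>
  then show ?case
    unfolding gbinomial_truncated_sum_Suc Suc.IH gbinomial_add_of_nat_Suc
    by (simp add: distrib_left mult.assoc)
qed

theorem theorem2p1:
  fixes n :: nat and s x :: complex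
  assumes "n \<ge> 1"
    and "s \<notin> {- of_nat m | m::nat. m \<ge> 1}"
  shows "(x \<noteq> -1 \<longrightarrow>
           (\<Sum>k=0..n. ((s + of_nat n) gchoose k) * x ^ k) =
           (1 + x) ^ n * (1 + s * (\<Sum>k=0..n-1. ((s + of_nat k) gchoose k) / of_nat (k + 1)
                                      * (x / (x + 1)) ^ (k + 1))))
       \<and> (\<Sum>k=0..n. ((s + of_nat n) gchoose k) * x ^ k) =
           (1 + x) ^ n + s * (\<Sum>k=0..n-1. ((s + of_nat k) gchoose k) / of_nat (k + 1)
                                 * (x ^ (k + 1) * (1 + x) ^ (n - k - 1)))"
proof -
  let ?c = "\<lambda>k. ((s + of_nat k) gchoose k) / of_nat (k + 1)"
  \<comment> \<open>This relies on \<open>n \<ge> 1\<close>: for \<open>n = 0\<close> the left side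
    would be \<open>{0}\<close>.\<close>
  have index: "{0..n-1} = {..<n}"
    using assms(1) by auto
  have poly: "(\<Sum>k=0..n. ((s + of_nat n) gchoose k) * x ^ k) =
      (1 + x) ^ n + s * (\<Sum>k=0..n-1. ?c k * (x ^ (k + 1) * (1 + x) ^ (n - k - 1)))"
    unfolding index using gbinomial_truncated_sum[of s n x] by (simp only: atLeast0AtMost)
  have "(1 + x) ^ n * (1 + s * (\<Sum>k=0..n-1. ?c k * (x / (x + 1)) ^ (k + 1))) =
      (1 + x) ^ n + s * (\<Sum>k=0..n-1. ?c k * (x ^ (k + 1) * (1 + x) ^ (n - k - 1)))"
    if "x \<noteq> -1"
  proof -
    have "1 + x \<noteq> 0"
      using that by (metis add_eq_0_iff)
    have "(1 + x) ^ n * (\<Sum>k=0..n-1. ?c k * (x / (x + 1)) ^ (k + 1)) =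
        (\<Sum>k=0..n-1. ?c k * (x ^ (k + 1) * (1 + x) ^ (n - k - 1)))"
      unfolding sum_distrib_left
    proof (rule sum.cong[OF refl])
      fix k assume "k \<in> {0..n-1}"
      \<comment> \<open>Of the \<open>n\<close> factors \<open>1 + x\<close>, \<open>k + 1\<close>
        cancel the denominators and the other \<open>n - k - 1\<close> remain.\<close>
      then have "n = (k + 1) + (n - k - 1)"
        using assms(1) by auto
      then have "(1 + x) ^ n = (1 + x) ^ (k + 1) * (1 + x) ^ (n - k - 1)"
        by (metis power_add)
      then have "(1 + x) ^ n * (?c k * (x / (x + 1)) ^ (k + 1)) =
          ?c k * (((1 + x) ^ (k + 1) * (x / (x + 1)) ^ (k + 1)) * (1 + x) ^ (n - k - 1))"
        by (simp only: ac_simps)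
      also have "(1 + x) ^ (k + 1) * (x / (x + 1)) ^ (k + 1) = x ^ (k + 1)"
        using \<open>1 + x \<noteq> 0\<close> by (simp only: power_mult_distrib[symmetric] add.commute[of x 1]) simp
      finally show "(1 + x) ^ n * (?c k * (x / (x + 1)) ^ (k + 1)) =
          ?c k * (x ^ (k + 1) * (1 + x) ^ (n - k - 1))" .
    qed
    then show ?thesis
      by (simp only: distrib_left mult_1_right mult.left_commute[of _ s])
  qed
  with poly show ?thesis
    by metis
qed

end
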